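(* Let $A\in\mathbb{Z}^{m\times n}$ with $\operatorname{rank}(A)=m$, $\bm{b}\in\mathbb{Z}^m$, $\bm{c}\in\mathbb{Z}^n$, such that the integer linear program $\max\{\bm{c}^\intercal\bm{x}\mid A\bm{x}=\bm{b},\ \bm{x}\in\mathbb{Z}^n_{\geq0}\}$ is feasible and has an optimal solution, and let $A_{\max}\coloneqq\max_i\|A_i\|_1$ be the largest $1$-norm of a column of $A$. Then for any $\alpha\in(0,1)$ there is an optimal solution $\bm{v}$ with support size $s=|\operatorname{supp}(\bm{v})|$ satisfying $$s\leq m\cdot\log\Bigl(\sqrt{2\log(e)/(e\cdot\alpha)}\cdot A_{\max}\Bigr)\big/(1-\alpha).$$
   Context: $\log$ denotes the base-2 logarithm and $e$ Euler's number. $\operatorname{supp}(\bm{v})$ is the set of indices of non-zero entries of $\bm{v}$. *)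

theory Defs
  imports "HOL-Analysis.Analysis"
begin

definition supp :: "'a::zero ^ 'n \<Rightarrow> 'n set" where
  "supp v = {j. v $ j \<noteq> 0}"

definition norm1 :: "int ^ 'm \<Rightarrow> int" where
  "norm1 v = (\<Sum>i\<in>UNIV. \<bar>v $ i\<bar>)"

definition A_max :: "int ^ 'n ^ 'm \<Rightarrow> int" where
  "A_max A = Max (range (\<lambda>j. norm1 (column j A)))"

text \<open>The order on vectors is componentwise, so \<open>0 \<le> x\<close> means that all entries are nonnegative.\<close>

definition ilp_feasible :: "int ^ 'n ^ 'm \<Rightarrow> int ^ 'm \<Rightarrow> int ^ 'n \<Rightarrow> bool" where
  "ilp_feasible A b x \<longleftrightarrow> A *v x = b \<and> 0 \<le> x"

definition ilp_optimal ::
  "int ^ 'n ^ 'm \<Rightarrow> int ^ 'm \<Rightarrow> int ^ 'n \<Rightarrow> int ^ 'n \<Rightarrow> bool" where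
  "ilp_optimal A b c x \<longleftrightarrow>
     ilp_feasible A b x \<and>
     (\<forall>y. ilp_feasible A b y \<longrightarrow> scalar_product c y \<le> scalar_product c x)"

end

theory Submission
  imports Defs
begin

text \<open>Let \<open>v\<close> be an optimal solution of minimal support \<open>S\<close>, and \<open>s = card S\<close>, \<open>m = CARD('m)\<close>. If two
  subsets of \<open>S\<close> had equal column sums, moving \<open>v\<close> along the difference of their indicators would
  preserve optimality and shrink the support. So the \<open>2 ^ s\<close> subset sums are distinct, and
  Parseval's identity on the group of \<open>m\<close>-tuples of integers modulo \<open>N\<close> shows that the average over
  \<open>\<theta>\<close> of the product over \<open>j \<in> S\<close> of \<open>cos (pi * (A\<^sub>j \<bullet> \<theta>) / N)\<^sup>2\<close> is exactly \<open>2 ^ (- s)\<close>. Since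
  \<open>ln \<circ> cos\<close> is concave and every column has 1-norm at most \<open>A_max\<close>, for small \<open>\<theta>\<close> the product is
  minorised by a product of one-dimensional functions of the \<open>\<theta>\<^sub>i\<close>. Letting \<open>N\<close> tend to infinity,
  with \<open>k = s / m \<ge> 1\<close>, the \<open>m\<close>-th power of
  \<open>2 / (pi * A_max)\<close> times the integral of \<open>cos x powr (2 * k)\<close> over \<open>{0..pi/2}\<close> is at most \<open>2 ^ (- s)\<close>.
  That integral is at least \<open>pi / (4 * sqrt k)\<close>, hence \<open>2 ^ s \<le> (2 * A_max * sqrt k) ^ m\<close>, and a tangent
  to the logarithm turns this into the claimed bound for every \<open>\<alpha>\<close>.\<close>

section \<open>Wallis integrals with real exponents\<close>

text \<open>The exponent is \<open>2 * k\<close> because squared cosines raised to the power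
  \<open>k\<close> occur below.\<close>

definition cos_powr_integral :: "real \<Rightarrow> real" where
  "cos_powr_integral k = integral {0..pi/2} (\<lambda>x. cos x powr (2 * k))"

lemma cos_nonneg_half: "x \<in> {0..pi/2} \<Longrightarrow> 0 \<le> cos (x::real)"
  by (auto intro!: cos_ge_zero order.trans[of _ 0 x])

lemma continuous_cos_powr:
  assumes "0 < (p::real)"
  shows "continuous_on {0..pi/2} (\<lambda>x::real. cos x powr p)"
  using assms by (intro continuous_on_powr' continuous_intros) (auto simp: cos_nonneg_half)

lemma cos_powr_integrable:
  assumes "0 < (p::real)"
  shows "(\<lambda>x::real. cos x powr p) integrable_on {0..pi/2}"
  by (intro integrable_continuous_interval continuous_cos_powr assms)

lemma cos_powr_integral_antimono:
  assumes "0 < k" "k \<le> k'"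
  shows "cos_powr_integral k' \<le> cos_powr_integral k"
  unfolding cos_powr_integral_def
  using assms by (intro integral_le cos_powr_integrable powr_mono') (auto simp: cos_nonneg_half)

text \<open>Wallis recurrence: the function \<open>sin x * cos x powr (2 * k + 1)\<close> vanishes
  at both endpoints, so its derivative, a combination of the two integrands, has integral 0.\<close>

lemma cos_powr_integral_Suc:
  assumes "0 < k"
  shows "cos_powr_integral (k + 1) * (k + 1) = cos_powr_integral k * (k + 1/2)"
proof -
  let ?F = "\<lambda>x::real. sin x * cos x powr (2 * k + 1)"
  let ?f = "\<lambda>x::real. (2 * k + 2) * cos x powr (2 * (k + 1)) - (2 * k + 1) * cos x powr (2 * k)"
  have "(?f has_integral (?F (pi/2) - ?F 0)) {0..pi/2}"
  proof (rule fundamental_theorem_of_calculus_interior)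
    show "continuous_on {0..pi/2} ?F"
      using assms by (intro continuous_on_mult continuous_cos_powr continuous_intros) auto
    fix x :: real assume x: "x \<in> {0<..<pi/2}"
    then have c: "0 < cos x" by (intro cos_gt_zero) auto
    have e: "cos x powr (2 * k + 1) = cos x powr (2 * k) * cos x"
      "cos x powr (2 * (k + 1)) = cos x powr (2 * k) * (cos x)\<^sup>2"
      using c by (simp_all add: powr_add distrib_left power2_eq_square powr_mult_base flip: powr_realpow)
    have s: "(sin x)\<^sup>2 = 1 - (cos x)\<^sup>2" by (simp add: sin_squared_eq)
    have "(?F has_real_derivative cos x * cos x powr (2 * k + 1)
        + sin x * ((2 * k + 1) * cos x powr (2 * k) * - sin x)) (at x)"
      using c by (auto intro!: derivative_eq_intros simp: field_simps)
    also have "cos x * cos x powr (2 * k + 1) + sin x * ((2 * k + 1) * cos x powr (2 * k) * - sin x)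
        = cos x powr (2 * k) * (cos x)\<^sup>2 - (2 * k + 1) * cos x powr (2 * k) * (sin x)\<^sup>2"
      unfolding e by (simp add: power2_eq_square)
    also have "\<dots> = ?f x"
      unfolding e s by (simp add: algebra_simps)
    finally show "(?F has_vector_derivative ?f x) (at x)"
      by (simp add: has_real_derivative_iff_has_vector_derivative)
  qed auto
  then have "integral {0..pi/2} ?f = 0"
    by (simp add: integral_unique)
  moreover have "integral {0..pi/2} ?f = (2 * k + 2) * cos_powr_integral (k + 1) - (2 * k + 1) * cos_powr_integral k"
    unfolding cos_powr_integral_def
    using assms cos_powr_integrable[of "2 * (k + 1)"] cos_powr_integrable[of "2 * k"]
    by (subst integral_diff) (auto intro: integrable_on_cmult_left)
  ultimately show ?thesis by (simp add: algebra_simps)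
qed

lemma cos_powr_integral_1: "cos_powr_integral 1 = pi / 4"
proof -
  have "((\<lambda>x::real. (cos x)\<^sup>2) has_integral
      ((pi/2) / 2 + sin (pi/2) * cos (pi/2) / 2 - (0 / 2 + sin 0 * cos 0 / 2))) {0..pi/2}"
  proof (rule fundamental_theorem_of_calculus)
    fix x :: real
    have "((\<lambda>x. x / 2 + sin x * cos x / 2) has_real_derivative (cos x)\<^sup>2) (at x)"
    proof -
      have "(sin x)\<^sup>2 = 1 - (cos x)\<^sup>2" by (simp add: sin_squared_eq)
      then have "1 / 2 + (cos x * cos x + - sin x * sin x) / 2 = (cos x)\<^sup>2"
        by (simp add: power2_eq_square diff_divide_distrib)
      then show ?thesis
        by (auto intro!: derivative_eq_intros simp: diff_divide_distrib add_divide_distrib)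
    qed
    then show "((\<lambda>x. x / 2 + sin x * cos x / 2) has_vector_derivative (cos x)\<^sup>2) (at x within {0..pi/2})"
      by (simp add: has_real_derivative_iff_has_vector_derivative has_vector_derivative_at_within)
  qed auto
  then have "integral {0..pi/2} (\<lambda>x::real. (cos x)\<^sup>2) = pi / 4"
    by (simp add: integral_unique)
  moreover have "cos_powr_integral 1 = integral {0..pi/2} (\<lambda>x::real. (cos x)\<^sup>2)"
    unfolding cos_powr_integral_def
    by (intro integral_cong) (auto simp: powr_numeral cos_nonneg_half)
  ultimately show ?thesis by simp
qed

text \<open>The recurrence carries positivity from 1 to every positive integer; antimonotonicity in
  \<open>k\<close> passes it on to real exponents.\<close>

lemma cos_powr_integral_pos:
  assumes "0 < k"
  shows "0 < cos_powr_integral k"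
proof -
  have *: "0 < cos_powr_integral (real n + 1)" for n
  proof (induction n)
    case 0 show ?case by (simp add: cos_powr_integral_1)
  next
    case (Suc n)
    have "0 < cos_powr_integral (real n + 1) * (real n + 1 + 1/2)"
      using Suc by (intro mult_pos_pos) auto
    then have "0 < cos_powr_integral (real n + 1 + 1) * (real n + 1 + 1)"
      using cos_powr_integral_Suc[of "real n + 1"] by simp
    then have "0 < cos_powr_integral (real n + 1 + 1)"
      by (simp only: zero_less_mult_iff) linarith
    then show ?case by (simp add: algebra_simps)
  qed
  obtain n where "k \<le> real n" using real_arch_simple by blast
  then have "cos_powr_integral (real n + 1) \<le> cos_powr_integral k"
    using assms by (intro cos_powr_integral_antimono) auto
  with *[of n] show ?thesis by linarith
qed

text \<open>The ratio of \<open>sqrt x * cos_powr_integral x\<close> at \<open>k + n\<close> and at \<open>1 + n\<close> decreases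
  in \<open>n\<close>, and its limit is at least 1.\<close>

lemma cos_powr_integral_ge:
  assumes k: "1 \<le> k"
  shows "pi / (4 * sqrt k) \<le> cos_powr_integral k"
proof -
  let ?I = cos_powr_integral
  define F where "F x = sqrt x * ?I x" for x
  define r where "r n = F (k + real n) / F (1 + real n)" for n
  have Fpos: "0 < F x" if "0 < x" for x
    using that cos_powr_integral_pos unfolding F_def by simp
  \<comment> \<open>\<open>q x\<close> is the ratio of \<open>F (x + 1)\<close> to
    \<open>F x\<close>. Its square is \<open>1 + 1 / (4 * (x * (x + 1)))\<close>, so it decreases in
    \<open>x\<close>, which is why \<open>r\<close> decreases.\<close>
  define q where "q x = (x + 1/2) / (sqrt x * sqrt (x + 1))" for x :: real
  have FS: "F (x + 1) = q x * F x" if "0 < x" for x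
  proof -
    have "?I (x + 1) = ?I x * (x + 1/2) / (x + 1)"
      using cos_powr_integral_Suc[OF that] that by (simp add: field_simps)
    then have "F (x + 1) = sqrt (x + 1) * (?I x * (x + 1/2) / (sqrt (x + 1) * sqrt (x + 1)))"
      using that by (simp add: F_def)
    also have "\<dots> = q x * F x"
      using that by (simp add: F_def q_def del: real_sqrt_mult_self)
    finally show ?thesis .
  qed
  have qpos: "0 < q x" if "0 < x" for x
    using that unfolding q_def by simp
  have q: "q y \<le> q x" if "0 < x" "x \<le> y" for x y
  proof -
    have sq: "(q z)\<^sup>2 = 1 + 1 / (4 * (z * (z + 1)))" if "0 < z" for z
    proof -
      have "(q z)\<^sup>2 = (z + 1/2)\<^sup>2 / (z * (z + 1))"
        using that by (simp add: q_def power_divide power_mult_distrib)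
      also have "(z + 1/2)\<^sup>2 = z * (z + 1) + 1/4"
        by (simp add: power2_eq_square algebra_simps)
      also have "(z * (z + 1) + 1/4) / (z * (z + 1)) = 1 + 1 / (4 * (z * (z + 1)))"
        using that by (subst add_divide_distrib) simp
      finally show ?thesis .
    qed
    have "x * (x + 1) \<le> y * (y + 1)" using that by (intro mult_mono) auto
    then have "(q y)\<^sup>2 \<le> (q x)\<^sup>2"
      using that sq[of x] sq[of y] by (simp add: frac_le)
    then show ?thesis using qpos that by (meson less_imp_le power2_le_imp_le)
  qed
  have "r (Suc n) \<le> r n" for n
  proof -
    have "r (Suc n) = (q (k + real n) / q (1 + real n)) * r n"
      unfolding r_def using FS[of "k + real n"] FS[of "1 + real n"] k by (simp add: add_ac)
    also have "\<dots> \<le> 1 * r n"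
      using q[of "1 + real n" "k + real n"] qpos[of "1 + real n"] Fpos[of "k + real n"] Fpos[of "1 + real n"] k
      by (intro mult_right_mono) (auto simp: r_def)
    finally show ?thesis by simp
  qed
  then have "r n \<le> r 0" for n
    using decseq_SucI[of r] unfolding decseq_def by blast
  moreover obtain p where p: "k \<le> real p" using real_arch_simple by blast
  \<comment> \<open>Since \<open>k \<le> p\<close>, applying the recurrence \<open>p\<close> times
    from \<open>1 + n\<close> reaches an argument at least \<open>k + n\<close>. Each application
    multiplies the integral by at least \<open>(n + 3/2) / (n + 2)\<close>, and with
    \<open>p\<close> fixed this lower bound tends to 1.\<close>
  have "((real n + 3/2) / (real n + 2)) ^ p \<le> r n" for n
  proof -
    have I: "?I (1 + real n + real j) \<ge> ((real n + 3/2) / (real n + 2)) ^ j * ?I (1 + real n)" for j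
    proof (induction j)
      case (Suc j)
      let ?x = "1 + real n + real j"
      have "(real n + 3/2) / (real n + 2) \<le> (?x + 1/2) / (?x + 1)"
        by (simp add: field_simps)
      then have "((real n + 3/2) / (real n + 2)) * (((real n + 3/2) / (real n + 2)) ^ j * ?I (1 + real n))
          \<le> (?x + 1/2) / (?x + 1) * ?I ?x"
        using Suc cos_powr_integral_pos[of "1 + real n"] by (intro mult_mono) (auto simp: less_imp_le)
      also have "\<dots> = ?I (?x + 1)"
        using cos_powr_integral_Suc[of ?x] by (simp add: field_simps)
      finally show ?case by (simp add: algebra_simps)
    qed simp
    have "((real n + 3/2) / (real n + 2)) ^ p * ?I (1 + real n) \<le> ?I (1 + real n + real p)"
      by (rule I)
    also have "\<dots> \<le> ?I (k + real n)"
      using k p by (intro cos_powr_integral_antimono) auto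
    finally have 1: "((real n + 3/2) / (real n + 2)) ^ p * ?I (1 + real n) \<le> ?I (k + real n)" .
    have "((real n + 3/2) / (real n + 2)) ^ p * F (1 + real n)
        = sqrt (1 + real n) * (((real n + 3/2) / (real n + 2)) ^ p * ?I (1 + real n))"
      by (simp add: F_def)
    also have "\<dots> \<le> sqrt (k + real n) * ?I (k + real n)"
      using 1 k cos_powr_integral_pos[of "1 + real n"] by (intro mult_mono) (auto simp: less_imp_le)
    finally show ?thesis
      using Fpos[of "1 + real n"] by (simp add: r_def F_def[of "k + real n"] pos_le_divide_eq)
  qed
  ultimately have "((real n + 3/2) / (real n + 2)) ^ p \<le> r 0" for n
    by (meson order.trans)
  moreover have "(\<lambda>n. ((real n + 3/2) / (real n + 2)) ^ p) \<longlonglongrightarrow> 1 ^ p"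
  proof (rule tendsto_power)
    have "(\<lambda>n. 1 - 1/2 * inverse (real (Suc (Suc n)))) \<longlonglongrightarrow> 1 - 1/2 * 0"
      by (intro tendsto_intros LIMSEQ_Suc[OF LIMSEQ_inverse_real_of_nat])
    moreover have "1 - 1/2 * inverse (real (Suc (Suc n))) = (real n + 3/2) / (real n + 2)" for n
      by (simp add: field_simps)
    ultimately show "(\<lambda>n. (real n + 3/2) / (real n + 2)) \<longlonglongrightarrow> 1" by simp
  qed
  ultimately have "1 \<le> r 0"
    by (intro LIMSEQ_le_const2[of _ 1]) auto
  then have "pi / 4 \<le> sqrt k * ?I k"
    using Fpos[of 1] by (simp add: r_def F_def cos_powr_integral_1 pos_le_divide_eq)
  then show ?thesis
    using k by (simp add: pos_divide_le_eq algebra_simps)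
qed

section \<open>Riemann sums of cosine powers\<close>

lemma integral_le_left_sum:
  fixes f :: "real \<Rightarrow> real"
  assumes cont: "continuous_on {0..real n * h} f" and h: "0 \<le> h"
    and dec: "\<And>x y. 0 \<le> x \<Longrightarrow> x \<le> y \<Longrightarrow> y \<le> real n * h \<Longrightarrow> f y \<le> f x"
  shows "integral {0..real n * h} f \<le> h * (\<Sum>i<n. f (real i * h))"
  using cont dec
proof (induction n)
  case (Suc n)
  have le: "real n * h \<le> real (Suc n) * h" "0 \<le> real n * h"
    using h by (auto simp: distrib_right)
  have sub: "continuous_on {0..real n * h} f" "continuous_on {real n * h..real (Suc n) * h} f"
    using le by (auto intro: continuous_on_subset[OF Suc.prems(1)])
  have "integral {real n * h..real (Suc n) * h} f \<le> integral {real n * h..real (Suc n) * h} (\<lambda>_. f (real n * h))"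
    using sub(2) le by (intro integral_le integrable_continuous_interval) (auto intro!: Suc.prems(2))
  also have "\<dots> = h * f (real n * h)"
    using le by (simp add: distrib_right)
  finally have "integral {real n * h..real (Suc n) * h} f \<le> h * f (real n * h)" .
  moreover have "integral {0..real n * h} f \<le> h * (\<Sum>i<n. f (real i * h))"
    by (rule Suc.IH[OF sub(1)]) (use le in \<open>auto intro!: Suc.prems(2)\<close>)
  moreover have "integral {0..real (Suc n) * h} f
      = integral {0..real n * h} f + integral {real n * h..real (Suc n) * h} f"
    using le by (intro Henstock_Kurzweil_Integration.integral_combine[symmetric] integrable_continuous_interval Suc.prems(1)) auto
  ultimately show ?case by (simp add: distrib_left)
qed simp

text \<open>The summand is even in \<open>j\<close>. Its part with \<open>j \<ge> 0\<close> is a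
  left Riemann sum of a decreasing function with step \<open>pi / (2 * M)\<close>, hence at least
  the integral. Doubling that part counts the term at \<open>j = 0\<close>, which is 1, twice; this
  is the \<open>- 1\<close>.\<close>

lemma sum_cos_powr_ge:
  assumes k: "0 < k" and M: "0 < (M::nat)"
  shows "2 * real M * (2 / pi * cos_powr_integral k) - 1
    \<le> (\<Sum>j\<in>{- int M<..<int M}. ((cos (pi * real_of_int j / (2 * real M)))\<^sup>2) powr k)"
proof -
  define h where "h = pi / (2 * real M)"
  define f where "f x = cos x powr (2 * k)" for x :: real
  have Mh: "real M * h = pi / 2" using M by (simp add: h_def)
  have "integral {0..real M * h} f \<le> h * (\<Sum>i<M. f (real i * h))"
  proof (rule integral_le_left_sum)
    show "continuous_on {0..real M * h} f"
      unfolding Mh f_def using k by (intro continuous_cos_powr) auto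
    show "f y \<le> f x" if "0 \<le> x" "x \<le> y" "y \<le> real M * h" for x y
      unfolding f_def using that k unfolding Mh
      by (intro powr_mono2 cos_monotone_0_pi_le) (auto simp: cos_nonneg_half)
  qed (simp add: h_def)
  then have I: "cos_powr_integral k \<le> h * (\<Sum>i<M. f (real i * h))"
    unfolding Mh cos_powr_integral_def f_def .
  let ?g = "\<lambda>j::int. ((cos (pi * real_of_int j / (2 * real M)))\<^sup>2) powr k"
  have g: "?g (int i) = f (real i * h)" "?g (- int i) = f (real i * h)" if "i < M" for i
  proof -
    have "real i * h \<le> real M * h" "0 \<le> real i * h"
      using that by (intro mult_right_mono) (auto simp: h_def)
    then have "0 \<le> cos (real i * h)" unfolding Mh by (intro cos_nonneg_half) auto
    then have "((cos (real i * h))\<^sup>2) powr k = f (real i * h)"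
      by (simp add: f_def powr_powr power2_eq_square powr_mult flip: powr_add)
    moreover have "pi * real_of_int (int i) / (2 * real M) = real i * h" by (simp add: h_def)
    ultimately show "?g (int i) = f (real i * h)" "?g (- int i) = f (real i * h)" by simp_all
  qed
  have "{- int M<..<int M} = int ` {..<M} \<union> (\<lambda>i. - int i) ` {1..<M}"
  proof (intro equalityI subsetI)
    fix x assume x: "x \<in> {- int M<..<int M}"
    show "x \<in> int ` {..<M} \<union> (\<lambda>i. - int i) ` {1..<M}"
    proof (cases "0 \<le> x")
      case True then show ?thesis using x by (intro UnI1 image_eqI[of _ _ "nat x"]) auto
    next
      case False then show ?thesis using x by (intro UnI2 image_eqI[of _ _ "nat (- x)"]) auto
    qed
  qed (use M in auto)
  then have "sum ?g {- int M<..<int M} = sum ?g (int ` {..<M}) + sum ?g ((\<lambda>i. - int i) ` {1..<M})"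
    by (auto intro!: sum.union_disjoint)
  also have "sum ?g (int ` {..<M}) = (\<Sum>i<M. f (real i * h))"
    using g by (subst sum.reindex) (auto simp: inj_on_def intro!: sum.cong)
  also have "sum ?g ((\<lambda>i. - int i) ` {1..<M}) = (\<Sum>i\<in>{1..<M}. f (real i * h))"
    using g by (subst sum.reindex) (auto simp: inj_on_def intro!: sum.cong)
  also have "(\<Sum>i\<in>{1..<M}. f (real i * h)) = (\<Sum>i<M. f (real i * h)) - 1"
  proof -
    have "{..<M} = insert 0 {1..<M}" using M by auto
    then show ?thesis by (simp add: f_def)
  qed
  finally have S: "sum ?g {- int M<..<int M} = 2 * (\<Sum>i<M. f (real i * h)) - 1" by simp
  have "2 * real M * (2 / pi * cos_powr_integral k) = 2 / h * cos_powr_integral k"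
    using M by (simp add: h_def)
  also have "\<dots> \<le> 2 / h * (h * (\<Sum>i<M. f (real i * h)))"
    by (rule mult_left_mono[OF I]) (simp add: h_def)
  also have "\<dots> = 2 * (\<Sum>i<M. f (real i * h))"
    using M by (simp add: h_def)
  finally show ?thesis unfolding S by simp
qed

section \<open>Fourier analysis on tuples of integers modulo \<open>N\<close>\<close>

lemma cis_sum: "finite I \<Longrightarrow> cis (sum f I) = (\<Prod>i\<in>I. cis (f i))"
  by (induction I rule: finite_induct) (simp_all flip: cis_mult)

text \<open>A geometric series whose ratio is an \<open>N\<close>-th root of unity, equal to 1
  exactly when \<open>N\<close> divides \<open>z\<close>. The free starting point \<open>h\<close>
  later allows a period centred at 0.\<close>

lemma sum_cis_period:
  fixes z h :: int
  assumes N: "0 < (N::nat)"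
  shows "(\<Sum>j\<in>{h..<h + int N}. cis (2 * pi * real_of_int (z * j) / real N))
    = (if int N dvd z then of_nat N else 0)"
proof -
  let ?w = "cis (2 * pi * real_of_int z / real N)"
  have "{h..<h + int N} = (\<lambda>i. h + int i) ` {..<N}"
  proof (intro equalityI subsetI)
    fix x assume "x \<in> {h..<h + int N}"
    then show "x \<in> (\<lambda>i. h + int i) ` {..<N}" by (intro image_eqI[of _ _ "nat (x - h)"]) auto
  qed auto
  then have "(\<Sum>j\<in>{h..<h + int N}. cis (2 * pi * real_of_int (z * j) / real N))
      = (\<Sum>i<N. cis (2 * pi * real_of_int (z * (h + int i)) / real N))"
    by (simp add: sum.reindex inj_on_def)
  also have "\<dots> = (\<Sum>i<N. cis (2 * pi * real_of_int (z * h) / real N) * ?w ^ i)"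
  proof (intro sum.cong refl)
    fix i
    have "2 * pi * real_of_int (z * (h + int i)) / real N
        = 2 * pi * real_of_int (z * h) / real N + real i * (2 * pi * real_of_int z / real N)"
      by (simp add: algebra_simps add_divide_distrib)
    then show "cis (2 * pi * real_of_int (z * (h + int i)) / real N)
        = cis (2 * pi * real_of_int (z * h) / real N) * ?w ^ i"
      by (simp only: cis_mult Complex.DeMoivre)
  qed
  also have "\<dots> = cis (2 * pi * real_of_int (z * h) / real N) * (\<Sum>i<N. ?w ^ i)"
    by (simp add: sum_distrib_left)
  finally have eq: "(\<Sum>j\<in>{h..<h + int N}. cis (2 * pi * real_of_int (z * j) / real N))
      = cis (2 * pi * real_of_int (z * h) / real N) * (\<Sum>i<N. ?w ^ i)" .
  show ?thesis
  proof (cases "int N dvd z")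
    case True
    then obtain q where q: "z = int N * q" ..
    have "cis (2 * pi * real_of_int (q * h)) = 1" "cis (2 * pi * real_of_int q) = 1"
      by (rule cis_multiple_2pi; simp)+
    moreover have "2 * pi * real_of_int (z * h) / real N = 2 * pi * real_of_int (q * h)"
      "2 * pi * real_of_int z / real N = 2 * pi * real_of_int q"
      using N by (simp_all add: q)
    ultimately show ?thesis unfolding eq using True by simp
  next
    case False
    have "?w \<noteq> 1"
    proof
      assume "?w = 1"
      then have "cos (2 * pi * real_of_int z / real N) = 1" by (simp add: complex_eq_iff)
      then obtain q :: int where "2 * pi * real_of_int z / real N = real_of_int q * 2 * pi"
        by (auto simp: cos_one_2pi_int)
      then have "real_of_int z = real_of_int (q * int N)" using N by (simp add: field_simps)
      then have "z = q * int N" by (simp only: of_int_eq_iff)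
      then show False using False by simp
    qed
    moreover have "?w ^ N = 1"
      using N by (simp add: Complex.DeMoivre cis_multiple_2pi)
    ultimately have "(\<Sum>i<N. ?w ^ i) = 0"
      by (simp add: geometric_sum)
    then show ?thesis unfolding eq using False by simp
  qed
qed

text \<open>After expanding the square, the sum over \<open>\<theta>\<close> of each cross term
  factors over the coordinates, and one coordinate in which the frequencies differ modulo
  \<open>N\<close> makes it vanish. Only the \<open>card P\<close> diagonal terms survive.\<close>

lemma parseval_period:
  fixes u :: "'t \<Rightarrow> 'i::finite \<Rightarrow> int"
  assumes N: "0 < (N::nat)" and P: "finite P"
    and dist: "\<And>T T'. T \<in> P \<Longrightarrow> T' \<in> P \<Longrightarrow> T \<noteq> T' \<Longrightarrow> \<exists>i. \<not> int N dvd (u T i - u T' i)"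
  shows "(\<Sum>\<theta>\<in>Pi\<^sub>E UNIV (\<lambda>_. {h..<h + int N}).
      (cmod (\<Sum>T\<in>P. cis (2 * pi * real_of_int (\<Sum>i\<in>UNIV. u T i * \<theta> i) / real N)))\<^sup>2)
    = real N ^ CARD('i) * real (card P)" (is "sum ?f ?\<Theta> = _")
proof -
  let ?e = "\<lambda>T \<theta>. cis (2 * pi * real_of_int (\<Sum>i\<in>UNIV. u T i * \<theta> i) / real N)"
  have e: "?e T \<theta> * cnj (?e T' \<theta>) = (\<Prod>i\<in>UNIV. cis (2 * pi * real_of_int ((u T i - u T' i) * \<theta> i) / real N))"
    for T T' and \<theta> :: "'i \<Rightarrow> int"
    by (simp add: cis_cnj cis_mult sum_subtractf algebra_simps sum_distrib_left
        sum_divide_distrib flip: cis_sum) (simp add: diff_divide_distrib sum_subtractf)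
  have in_sum: "(\<Sum>\<theta>\<in>?\<Theta>. ?e T \<theta> * cnj (?e T' \<theta>)) = (if T' = T then of_nat N ^ CARD('i) else 0)"
    if TT: "T \<in> P" "T' \<in> P" for T T'
  proof -
    have "(\<Sum>\<theta>\<in>?\<Theta>. ?e T \<theta> * cnj (?e T' \<theta>))
        = (\<Prod>i\<in>UNIV. \<Sum>j\<in>{h..<h + int N}. cis (2 * pi * real_of_int ((u T i - u T' i) * j) / real N))"
      unfolding e by (subst prod_sum_PiE) auto
    also have "\<dots> = (\<Prod>i\<in>UNIV. if int N dvd (u T i - u T' i) then of_nat N else 0)"
      by (subst sum_cis_period[OF N]) simp
    also have "\<dots> = (if T' = T then of_nat N ^ CARD('i) else 0)"
    proof (cases "T' = T")
      case False
      then obtain i where "\<not> int N dvd (u T i - u T' i)" using dist[of T T'] TT by auto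
      then show ?thesis using False by (auto intro!: prod_zero)
    qed simp
    finally show ?thesis .
  qed
  have "complex_of_real (sum ?f ?\<Theta>) = (\<Sum>\<theta>\<in>?\<Theta>. (\<Sum>T\<in>P. ?e T \<theta>) * cnj (\<Sum>T\<in>P. ?e T \<theta>))"
    by (simp only: of_real_sum complex_norm_square[symmetric])
  also have "\<dots> = (\<Sum>\<theta>\<in>?\<Theta>. \<Sum>T\<in>P. \<Sum>T'\<in>P. ?e T \<theta> * cnj (?e T' \<theta>))"
    by (simp only: cnj_sum sum_product)
  also have "\<dots> = (\<Sum>T\<in>P. \<Sum>\<theta>\<in>?\<Theta>. \<Sum>T'\<in>P. ?e T \<theta> * cnj (?e T' \<theta>))"
    by (rule sum.swap)
  also have "\<dots> = (\<Sum>T\<in>P. \<Sum>T'\<in>P. \<Sum>\<theta>\<in>?\<Theta>. ?e T \<theta> * cnj (?e T' \<theta>))"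
    by (intro sum.cong refl sum.swap)
  also have "\<dots> = (\<Sum>T\<in>P. \<Sum>T'\<in>P. if T' = T then of_nat N ^ CARD('i) else 0)"
    by (intro sum.cong refl in_sum)
  also have "\<dots> = (\<Sum>T\<in>P. of_nat N ^ CARD('i))"
    using P by (intro sum.cong refl) (simp add: sum.delta)
  also have "\<dots> = complex_of_real (real N ^ CARD('i) * real (card P))"
    by simp
  finally show ?thesis by (simp only: of_real_eq_iff)
qed

text \<open>With \<open>1 + cis (2 * t)\<close> for every column, the product expands into the exponentials of
  all subset sums, and \<open>(cmod (1 + cis (2 * t)))\<^sup>2 = 4 * (cos t)\<^sup>2\<close>.\<close>

lemma sum_prod_cos_period:
  fixes a :: "'j \<Rightarrow> 'i::finite \<Rightarrow> int"
  assumes N: "0 < (N::nat)" and S: "finite S"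
    and dist: "\<And>T T'. T \<subseteq> S \<Longrightarrow> T' \<subseteq> S \<Longrightarrow> T \<noteq> T' \<Longrightarrow>
      \<exists>i. \<not> int N dvd ((\<Sum>j\<in>T. a j i) - (\<Sum>j\<in>T'. a j i))"
  shows "2 ^ card S * (\<Sum>\<theta>\<in>Pi\<^sub>E UNIV (\<lambda>_. {h..<h + int N}).
      \<Prod>j\<in>S. (cos (pi * real_of_int (\<Sum>i\<in>UNIV. a j i * \<theta> i) / real N))\<^sup>2)
    = real N ^ CARD('i)"
proof -
  let ?\<Theta> = "Pi\<^sub>E (UNIV :: 'i set) (\<lambda>_. {h..<h + int N})"
  let ?t = "\<lambda>j \<theta>. pi * real_of_int (\<Sum>i\<in>UNIV. a j i * \<theta> i) / real N"
  let ?e = "\<lambda>T \<theta>. cis (2 * pi * real_of_int (\<Sum>i\<in>UNIV. (\<Sum>j\<in>T. a j i) * \<theta> i) / real N)"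
  have norm: "(cmod (1 + cis (2 * t)))\<^sup>2 = 4 * (cos t)\<^sup>2" for t
  proof -
    have "(cmod (1 + cis (2 * t)))\<^sup>2 = (1 + cos (2 * t))\<^sup>2 + (sin (2 * t))\<^sup>2"
      by (simp add: cmod_power2)
    also have "\<dots> = 1 + 2 * cos (2 * t) + ((sin (2 * t))\<^sup>2 + (cos (2 * t))\<^sup>2)"
      by (simp add: power2_eq_square algebra_simps)
    also have "\<dots> = 4 * (cos t)\<^sup>2"
      by (simp only: sin_cos_squared_add) (simp add: cos_double_cos)
    finally show ?thesis .
  qed
  have expand: "(\<Prod>j\<in>S. 4 * (cos (?t j \<theta>))\<^sup>2) = (cmod (\<Sum>T\<in>Pow S. ?e T \<theta>))\<^sup>2" for \<theta>
  proof -
    have "?e T \<theta> = (\<Prod>j\<in>T. cis (2 * ?t j \<theta>))" if "T \<in> Pow S" for T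
    proof -
      have T: "finite T" using that S by (auto intro: finite_subset)
      have "(\<Sum>i\<in>UNIV. (\<Sum>j\<in>T. a j i) * \<theta> i) = (\<Sum>j\<in>T. \<Sum>i\<in>UNIV. a j i * \<theta> i)"
        unfolding sum_distrib_right by (rule sum.swap)
      then have "2 * pi * real_of_int (\<Sum>i\<in>UNIV. (\<Sum>j\<in>T. a j i) * \<theta> i) / real N = (\<Sum>j\<in>T. 2 * ?t j \<theta>)"
        by (simp only: of_int_sum sum_distrib_left sum_divide_distrib mult.assoc times_divide_eq_right)
      then show ?thesis using cis_sum[OF T, of "\<lambda>j. 2 * ?t j \<theta>"] by simp
    qed
    then have "(\<Sum>T\<in>Pow S. ?e T \<theta>) = (\<Sum>T\<in>Pow S. \<Prod>j\<in>T. cis (2 * ?t j \<theta>))"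
      by (rule sum.cong[OF refl])
    also have "\<dots> = (\<Prod>j\<in>S. cis (2 * ?t j \<theta>) + 1)"
      by (subst prod_add[OF S]) simp
    finally have "(\<Sum>T\<in>Pow S. ?e T \<theta>) = (\<Prod>j\<in>S. 1 + cis (2 * ?t j \<theta>))"
      by (simp only: add.commute)
    then have "(cmod (\<Sum>T\<in>Pow S. ?e T \<theta>))\<^sup>2 = (\<Prod>j\<in>S. (cmod (1 + cis (2 * ?t j \<theta>)))\<^sup>2)"
      by (simp only: prod_norm[symmetric] prod_power_distrib)
    then show ?thesis by (simp only: norm)
  qed
  have "(\<Sum>\<theta>\<in>?\<Theta>. (cmod (\<Sum>T\<in>Pow S. ?e T \<theta>))\<^sup>2) = real N ^ CARD('i) * real (card (Pow S))"
    using S dist by (intro parseval_period N) auto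
  then have "(\<Sum>\<theta>\<in>?\<Theta>. \<Prod>j\<in>S. 4 * (cos (?t j \<theta>))\<^sup>2) = real N ^ CARD('i) * 2 ^ card S"
    unfolding expand using S by (simp add: card_Pow)
  \<comment> \<open>The factors 4 contribute \<open>4 ^ card S\<close>; half of this exponent
    cancels against the number \<open>2 ^ card S\<close> of subsets.\<close>
  moreover have "(\<Sum>\<theta>\<in>?\<Theta>. \<Prod>j\<in>S. 4 * (cos (?t j \<theta>))\<^sup>2)
      = 2 ^ card S * (2 ^ card S * (\<Sum>\<theta>\<in>?\<Theta>. \<Prod>j\<in>S. (cos (?t j \<theta>))\<^sup>2))"
    unfolding prod.distrib
    by (simp add: sum_distrib_left flip: mult.assoc power_mult_distrib)
  ultimately show ?thesis by simp
qed

section \<open>Two convexity inequalities\<close>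

text \<open>Jensen's inequality for the concave function \<open>ln (cos x)\<close> between
  \<open>- pi/2\<close> and \<open>pi/2\<close>, in exponentiated form.\<close>

lemma prod_cos_powr_le:
  fixes w x :: "'i \<Rightarrow> real"
  assumes I: "finite I" and w: "\<And>i. i \<in> I \<Longrightarrow> 0 \<le> w i" "(\<Sum>i\<in>I. w i) \<le> 1"
    and x: "\<And>i. i \<in> I \<Longrightarrow> \<bar>x i\<bar> < pi / 2"
  shows "(\<Prod>i\<in>I. cos (x i) powr w i) \<le> cos (\<Sum>i\<in>I. w i * x i)"
proof -
  let ?C = "{- (pi/2)<..<pi/2}"
  have pos: "0 < cos y" if "y \<in> ?C" for y
    using that by (intro cos_gt_zero_pi) auto
  have conv: "convex_on ?C (\<lambda>y. - ln (cos y))"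
  proof (rule f''_ge0_imp_convex)
    show "((\<lambda>y. - ln (cos y)) has_real_derivative tan y) (at y)" if "y \<in> ?C" for y
      using pos[OF that] by (auto intro!: derivative_eq_intros simp: tan_def)
    show "(tan has_real_derivative inverse ((cos y)\<^sup>2)) (at y)" if "y \<in> ?C" for y
      using pos[OF that] by (auto intro!: DERIV_tan)
  qed auto
  have xC: "x i \<in> ?C" if "i \<in> I" for i
    using abs_less_iff[THEN iffD1, OF x[OF that]] by auto
  text \<open>The missing weight is put on the point \<open>0\<close>, where the logarithm of the cosine vanishes.\<close>
  let ?J = "insert None (Some ` I)"
  let ?a = "case_option (1 - (\<Sum>i\<in>I. w i)) w"
  let ?y = "case_option 0 x"
  have J: "(\<Sum>i\<in>?J. f i) = f None + (\<Sum>i\<in>I. f (Some i))" for f :: "'i option \<Rightarrow> real"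
    using I by (simp add: sum.reindex)
  have "- ln (cos (\<Sum>i\<in>?J. ?a i *\<^sub>R ?y i)) \<le> (\<Sum>i\<in>?J. ?a i * - ln (cos (?y i)))"
  proof (rule convex_on_sum[OF _ _ conv])
    show "sum ?a ?J = 1" unfolding J by simp
    show "?a i \<ge> 0" if "i \<in> ?J" for i using that w by auto
    show "?y i \<in> ?C" if "i \<in> ?J" for i using that xC by auto
  qed (use I in auto)
  then have 1: "(\<Sum>i\<in>I. w i * ln (cos (x i))) \<le> ln (cos (\<Sum>i\<in>I. w i * x i))"
    unfolding J by (simp add: sum_negf)
  \<comment> \<open>The cosine of the weighted sum must be positive for \<open>exp\<close> to undo
    \<open>ln\<close>.\<close>
  have "\<bar>\<Sum>i\<in>I. w i * x i\<bar> < pi / 2"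
  proof (cases "I = {}")
    case False
    define m where "m = Max ((\<lambda>i. \<bar>x i\<bar>) ` I)"
    have m: "\<bar>x i\<bar> \<le> m" if "i \<in> I" for i using that I by (simp add: m_def)
    have "m \<in> (\<lambda>i. \<bar>x i\<bar>) ` I" unfolding m_def using False I by (intro Max_in) auto
    then have mm: "0 \<le> m" "m < pi / 2" using x by auto
    have "\<bar>\<Sum>i\<in>I. w i * x i\<bar> \<le> (\<Sum>i\<in>I. \<bar>w i * x i\<bar>)" by (rule sum_abs)
    also have "\<dots> \<le> (\<Sum>i\<in>I. w i * m)"
      using w m by (intro sum_mono) (auto simp: abs_mult intro!: mult_left_mono)
    also have "\<dots> = (\<Sum>i\<in>I. w i) * m" by (simp add: sum_distrib_right)
    also have "\<dots> \<le> 1 * m" using w mm by (intro mult_right_mono) auto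
    finally show ?thesis using mm by simp
  qed simp
  then have 2: "0 < cos (\<Sum>i\<in>I. w i * x i)"
    by (intro pos) (auto simp: abs_less_iff)
  have "cos (x i) \<noteq> 0" if "i \<in> I" for i
    using pos[OF xC[OF that]] by simp
  then have "(\<Prod>i\<in>I. cos (x i) powr w i) = exp (\<Sum>i\<in>I. w i * ln (cos (x i)))"
    unfolding exp_sum[OF I] by (intro prod.cong refl) (simp add: powr_def)
  also have "\<dots> \<le> exp (ln (cos (\<Sum>i\<in>I. w i * x i)))"
    using 1 by simp
  finally show ?thesis using 2 by simp
qed

text \<open>Log-convexity of \<open>d \<mapsto> \<Sum>j\<in>J. c j powr d\<close>, in the form of a supporting line at \<open>k\<close>.\<close>

lemma sum_powr_support_line:
  fixes c :: "'a \<Rightarrow> real"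
  assumes J: "finite J" "J \<noteq> {}" and c: "\<And>j. j \<in> J \<Longrightarrow> 0 < c j" "\<And>j. j \<in> J \<Longrightarrow> c j \<le> 1"
  obtains l where "l \<le> 0"
    "\<And>d. (\<Sum>j\<in>J. c j powr k) * exp (l * (d - k)) \<le> (\<Sum>j\<in>J. c j powr d)"
proof -
  define Z where "Z = (\<Sum>j\<in>J. c j powr k)"
  \<comment> \<open>\<open>l\<close> is the derivative at \<open>k\<close> of the logarithm of the
    power sum, a weighted mean of the numbers \<open>ln (c j)\<close>. These are nonpositive because
    \<open>c j \<le> 1\<close>, which gives the sign of \<open>l\<close>.\<close>
  define l where "l = (\<Sum>j\<in>J. c j powr k * ln (c j)) / Z"
  have Z: "0 < Z" unfolding Z_def using J c by (intro sum_pos) (auto simp: less_le)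
  show ?thesis
  proof
    show "l \<le> 0"
      unfolding l_def using Z c
      by (intro divide_nonpos_pos sum_nonpos mult_nonneg_nonpos) auto
    fix d
    \<comment> \<open>The two added terms cancel. They distribute the left side over
      \<open>J\<close> in such a way that \<open>1 + x \<le> exp x\<close> applies to every
      summand.\<close>
    have "Z * exp (l * (d - k)) = exp (l * (d - k)) * (Z * (1 - l * (d - k)) + (d - k) * (l * Z))"
      by (simp add: algebra_simps)
    also have "l * Z = (\<Sum>j\<in>J. c j powr k * ln (c j))" using Z by (simp add: l_def)
    also have "exp (l * (d - k)) * (Z * (1 - l * (d - k)) + (d - k) * (\<Sum>j\<in>J. c j powr k * ln (c j)))
        = (\<Sum>j\<in>J. c j powr k * (exp (l * (d - k)) * (1 + ((d - k) * ln (c j) - l * (d - k)))))"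
      unfolding Z_def by (simp add: sum_distrib_left sum_distrib_right sum.distrib sum_subtractf algebra_simps)
    also have "\<dots> \<le> (\<Sum>j\<in>J. c j powr k * exp ((d - k) * ln (c j)))"
    proof (intro sum_mono mult_left_mono)
      fix j
      have "exp (l * (d - k)) * (1 + ((d - k) * ln (c j) - l * (d - k)))
          \<le> exp (l * (d - k)) * exp ((d - k) * ln (c j) - l * (d - k))"
        by (intro mult_left_mono exp_ge_add_one_self) auto
      also have "\<dots> = exp ((d - k) * ln (c j))" by (simp flip: exp_add)
      finally show "exp (l * (d - k)) * (1 + ((d - k) * ln (c j) - l * (d - k))) \<le> exp ((d - k) * ln (c j))" .
    qed simp
    also have "\<dots> = (\<Sum>j\<in>J. c j powr d)"
    proof (intro sum.cong refl)
      fix j assume "j \<in> J"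
      then have "c j \<noteq> 0" using c by force
      then show "c j powr k * exp ((d - k) * ln (c j)) = c j powr d"
        by (simp add: powr_def algebra_simps flip: exp_add)
    qed
    finally show "(\<Sum>j\<in>J. c j powr k) * exp (l * (d - k)) \<le> (\<Sum>j\<in>J. c j powr d)"
      by (simp add: Z_def)
  qed
qed

section \<open>From distinct subset sums to a bound on their number\<close>

text \<open>In a coordinate where the two sums differ, the difference is at most
  \<open>card S * A < N\<close> in absolute value, too small for a nonzero multiple of
  \<open>N\<close>.\<close>

lemma subset_sums_not_congruent:
  fixes a :: "'j \<Rightarrow> 'i::finite \<Rightarrow> int"
  assumes S: "finite S" and a: "\<And>j. j \<in> S \<Longrightarrow> (\<Sum>i\<in>UNIV. \<bar>a j i\<bar>) \<le> int A"
    and inj: "inj_on (\<lambda>T i. \<Sum>j\<in>T. a j i) (Pow S)" and N: "card S * A < N"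
    and T: "T \<subseteq> S" "T' \<subseteq> S" "T \<noteq> T'"
  shows "\<exists>i. \<not> int N dvd ((\<Sum>j\<in>T. a j i) - (\<Sum>j\<in>T'. a j i))"
proof -
  obtain i where i: "(\<Sum>j\<in>T. a j i) \<noteq> (\<Sum>j\<in>T'. a j i)"
    using inj T unfolding inj_on_def by blast
  have ind: "(\<Sum>j\<in>U. a j i) = (\<Sum>j\<in>S. if j \<in> U then a j i else 0)" if "U \<subseteq> S" for U
    using S that by (simp add: sum.If_cases Int_absorb1)
  have "\<bar>(\<Sum>j\<in>T. a j i) - (\<Sum>j\<in>T'. a j i)\<bar>
      = \<bar>\<Sum>j\<in>S. (if j \<in> T then a j i else 0) - (if j \<in> T' then a j i else 0)\<bar>"
    using T by (simp add: ind sum_subtractf)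
  also have "\<dots> \<le> (\<Sum>j\<in>S. \<bar>(if j \<in> T then a j i else 0) - (if j \<in> T' then a j i else 0)\<bar>)"
    by (rule sum_abs)
  also have "\<dots> \<le> (\<Sum>j\<in>S. int A)"
  proof (intro sum_mono)
    fix j assume j: "j \<in> S"
    have "\<bar>a j i\<bar> \<le> (\<Sum>i\<in>UNIV. \<bar>a j i\<bar>)" by (rule member_le_sum) auto
    then show "\<bar>(if j \<in> T then a j i else 0) - (if j \<in> T' then a j i else 0)\<bar> \<le> int A"
      using a[OF j] by auto
  qed
  also have "\<dots> < int N" using N by (simp flip: of_nat_mult)
  finally show ?thesis
    using i dvd_imp_le_int by (metis abs_of_nat eq_iff_diff_eq_0 not_less)
qed

text \<open>The Parseval identity is restricted to the box of \<open>\<theta>\<close> with all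
  entries below \<open>M\<close> in absolute value, where Jensen's inequality separates the
  coordinates. The resulting exponents differ between coordinates; the supporting line replaces them
  by the common \<open>k\<close>.\<close>

lemma subset_sums_power_bound:
  fixes a :: "'j \<Rightarrow> 'i::finite \<Rightarrow> int"
  assumes S: "finite S" and A: "0 < (A::nat)" and M: "0 < (M::nat)" "card S < 2 * M"
    and a: "\<And>j. j \<in> S \<Longrightarrow> (\<Sum>i\<in>UNIV. \<bar>a j i\<bar>) \<le> int A"
    and inj: "inj_on (\<lambda>T i. \<Sum>j\<in>T. a j i) (Pow S)"
    and k: "real (card S) \<le> k * real CARD('i)"
  shows "2 ^ card S * (\<Sum>j\<in>{- int M<..<int M}. ((cos (pi * real_of_int j / (2 * real M)))\<^sup>2) powr k) ^ CARD('i)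
    \<le> (2 * real A * real M) ^ CARD('i)"
proof -
  \<comment> \<open>With this modulus,
    \<open>pi * (\<Sum>i\<in>UNIV. a j i * \<theta> i) / N\<close> is a combination of the angles
    \<open>pi * \<theta> i / (2 * M)\<close> with coefficients \<open>a j i / A\<close>, whose
    absolute values sum to at most 1. Also \<open>N\<close> exceeds \<open>card S * A\<close>, since
    \<open>card S < 2 * M\<close>.\<close>
  define N where "N = 2 * A * M"
  define h where "h = - int (A * M)"
  define J where "J = {- int M<..<int M}"
  define c where "c j = (cos (pi * real_of_int j / (2 * real M)))\<^sup>2" for j :: int
  define Z where "Z d = (\<Sum>j\<in>J. c j powr d)" for d
  \<comment> \<open>\<open>d i\<close> is the total exponent that coordinate \<open>i\<close>
    collects from all columns.\<close>
  define d where "d i = (\<Sum>j\<in>S. \<bar>real_of_int (a j i)\<bar> / real A)" for i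
  let ?\<Theta> = "Pi\<^sub>E (UNIV :: 'i set) (\<lambda>_. {h..<h + int N})"
  let ?B = "Pi\<^sub>E (UNIV :: 'i set) (\<lambda>_. J)"
  let ?t = "\<lambda>j \<theta>. pi * real_of_int (\<Sum>i\<in>UNIV. a j i * \<theta> i) / real N"
  have N: "0 < N" "card S * A < N" using A M by (auto simp: N_def)
  have "0 \<in> J" using M by (simp add: J_def)
  then have J: "finite J" "J \<noteq> {}" unfolding J_def by (simp, blast)
  have half: "\<bar>pi * real_of_int j / (2 * real M)\<bar> < pi / 2" if "j \<in> J" for j
  proof -
    have "\<bar>real_of_int j\<bar> < real M" using that by (auto simp: J_def)
    then show ?thesis using M by (simp add: abs_mult field_simps)
  qed
  have cpos: "0 < cos (pi * real_of_int j / (2 * real M))" if "j \<in> J" for j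
    using abs_less_iff[THEN iffD1, OF half[OF that]] by (intro cos_gt_zero_pi) auto
  have c: "0 < c j" "c j \<le> 1" if "j \<in> J" for j
    using cpos[OF that] by (auto simp: c_def abs_square_le_1)
  have "J \<subseteq> {h..<h + int N}"
  proof
    fix x assume "x \<in> J"
    then have "- int M < x" "x < int M" by (auto simp: J_def)
    moreover have "M \<le> A * M" using A by simp
    then have "int M \<le> int (A * M)" by (simp only: of_nat_le_iff)
    moreover have "h + int N = int (A * M)" by (simp add: h_def N_def)
    ultimately show "x \<in> {h..<h + int N}"
      unfolding h_def atLeastLessThan_iff by linarith
  qed
  then have sub: "?B \<subseteq> ?\<Theta>" by (intro PiE_mono) auto

  have low: "(\<Prod>i\<in>UNIV. c (\<theta> i) powr d i) \<le> (\<Prod>j\<in>S. (cos (?t j \<theta>))\<^sup>2)" if \<theta>: "\<theta> \<in> ?B" for \<theta>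
  proof -
    have \<theta>J: "\<theta> i \<in> J" for i using \<theta> by auto
    have "(\<Prod>i\<in>UNIV. c (\<theta> i) powr d i) = (\<Prod>i\<in>UNIV. \<Prod>j\<in>S. c (\<theta> i) powr (\<bar>real_of_int (a j i)\<bar> / real A))"
    proof (intro prod.cong refl)
      fix i
      have "c (\<theta> i) \<noteq> 0" using c[OF \<theta>J[of i]] by simp
      then show "c (\<theta> i) powr d i = (\<Prod>j\<in>S. c (\<theta> i) powr (\<bar>real_of_int (a j i)\<bar> / real A))"
        unfolding d_def by (rule powr_sum)
    qed
    also have "\<dots> = (\<Prod>j\<in>S. \<Prod>i\<in>UNIV. c (\<theta> i) powr (\<bar>real_of_int (a j i)\<bar> / real A))"
      by (rule prod.swap)
    also have "\<dots> \<le> (\<Prod>j\<in>S. (cos (?t j \<theta>))\<^sup>2)"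
    proof (intro prod_mono conjI prod_nonneg)
      fix j assume j: "j \<in> S"
      let ?w = "\<lambda>i. \<bar>real_of_int (a j i)\<bar> / real A"
      \<comment> \<open>The sign of the entry moves into the angle, so that the weights are
        nonnegative; the cosine is even and does not see it. For a zero entry the exponent is 0 and
        both powers are 1.\<close>
      let ?x = "\<lambda>i. real_of_int (sgn (a j i)) * (pi * real_of_int (\<theta> i) / (2 * real M))"
      have cx: "cos (?x i) powr ?w i = cos (pi * real_of_int (\<theta> i) / (2 * real M)) powr ?w i" for i
        using cpos[OF \<theta>J[of i]] by (cases "a j i" "0::int" rule: linorder_cases) auto
      have "(\<Prod>i\<in>UNIV. cos (?x i) powr ?w i) \<le> cos (\<Sum>i\<in>UNIV. ?w i * ?x i)"
      proof (rule prod_cos_powr_le)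
        have "real_of_int (\<Sum>i\<in>UNIV. \<bar>a j i\<bar>) \<le> real_of_int (int A)"
          using a[OF j] by (simp only: of_int_le_iff)
        then show "(\<Sum>i\<in>UNIV. ?w i) \<le> 1"
          using A by (simp add: pos_divide_le_eq flip: sum_divide_distrib)
        show "\<bar>?x i\<bar> < pi / 2" for i
          using half[OF \<theta>J[of i]] by (cases "a j i" "0::int" rule: linorder_cases) auto
      qed auto
      also have "(\<Sum>i\<in>UNIV. ?w i * ?x i) = ?t j \<theta>"
      proof -
        have "?w i * ?x i = pi * real_of_int (a j i * \<theta> i) / real N" for i
        proof -
          have "\<bar>real_of_int (a j i)\<bar> * real_of_int (sgn (a j i)) = real_of_int (a j i)"
            by (simp flip: of_int_mult of_int_abs add: abs_mult_sgn)
          then show ?thesis by (simp add: N_def field_simps)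
        qed
        then show ?thesis by (simp add: sum_distrib_left sum_divide_distrib)
      qed
      finally have "(\<Prod>i\<in>UNIV. cos (pi * real_of_int (\<theta> i) / (2 * real M)) powr ?w i) \<le> cos (?t j \<theta>)"
        by (simp only: cx)
      then have "(\<Prod>i\<in>UNIV. cos (pi * real_of_int (\<theta> i) / (2 * real M)) powr ?w i)\<^sup>2 \<le> (cos (?t j \<theta>))\<^sup>2"
        by (intro power_mono prod_nonneg) auto
      moreover have "(\<Prod>i\<in>UNIV. cos (pi * real_of_int (\<theta> i) / (2 * real M)) powr ?w i)\<^sup>2
          = (\<Prod>i\<in>UNIV. c (\<theta> i) powr ?w i)"
        by (simp add: c_def power2_eq_square powr_mult prod.distrib)
      ultimately show "(\<Prod>i\<in>UNIV. c (\<theta> i) powr ?w i) \<le> (cos (?t j \<theta>))\<^sup>2" by simp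
    qed auto
    finally show ?thesis .
  qed

  \<comment> \<open>Only the sum of the \<open>d i\<close> is controlled: it is at most
    \<open>k * CARD('i)\<close>. Together with \<open>l \<le> 0\<close> this makes the product of
    the exponential factors at least 1.\<close>
  obtain l where l: "l \<le> 0" "\<And>d. Z k * exp (l * (d - k)) \<le> Z d"
  proof (rule sum_powr_support_line[OF J c, where k = k])
    fix l
    assume "l \<le> 0"
      and "\<And>d. (\<Sum>j\<in>J. c j powr k) * exp (l * (d - k)) \<le> (\<Sum>j\<in>J. c j powr d)"
    then show thesis by (intro that[of l]) (simp_all add: Z_def)
  qed
  have "(\<Sum>i\<in>UNIV. d i) = (\<Sum>j\<in>S. \<Sum>i\<in>UNIV. \<bar>real_of_int (a j i)\<bar> / real A)"
    unfolding d_def by (rule sum.swap)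
  also have "\<dots> \<le> (\<Sum>j\<in>S. 1)"
  proof (intro sum_mono)
    fix j assume "j \<in> S"
    then have "real_of_int (\<Sum>i\<in>UNIV. \<bar>a j i\<bar>) \<le> real_of_int (int A)"
      using a by (simp only: of_int_le_iff)
    then show "(\<Sum>i\<in>UNIV. \<bar>real_of_int (a j i)\<bar> / real A) \<le> 1"
      using A by (simp add: pos_divide_le_eq flip: sum_divide_distrib)
  qed
  also have "\<dots> \<le> k * real CARD('i)" using k by simp
  finally have d: "(\<Sum>i\<in>UNIV. d i - k) \<le> 0" by (simp add: sum_subtractf mult.commute)
  have Z0: "0 \<le> Z d" for d unfolding Z_def by (intro sum_nonneg) auto
  have "Z k ^ CARD('i) * 1 \<le> Z k ^ CARD('i) * exp (\<Sum>i\<in>UNIV. l * (d i - k))"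
    using l(1) d Z0 by (intro mult_left_mono) (auto simp: mult_nonpos_nonpos simp flip: sum_distrib_left)
  also have "\<dots> = (\<Prod>i\<in>UNIV. Z k * exp (l * (d i - k)))"
    by (simp add: exp_sum prod.distrib)
  also have "\<dots> \<le> (\<Prod>i\<in>UNIV. Z (d i))"
    using l(2) Z0 by (intro prod_mono) auto
  also have "\<dots> = (\<Sum>\<theta>\<in>?B. \<Prod>i\<in>UNIV. c (\<theta> i) powr d i)"
    unfolding Z_def using J by (subst prod_sum_PiE) auto
  also have "\<dots> \<le> (\<Sum>\<theta>\<in>?B. \<Prod>j\<in>S. (cos (?t j \<theta>))\<^sup>2)"
    by (intro sum_mono low)
  \<comment> \<open>The terms outside the box are products of squares, so including them only
    increases the sum.\<close>
  also have "\<dots> \<le> (\<Sum>\<theta>\<in>?\<Theta>. \<Prod>j\<in>S. (cos (?t j \<theta>))\<^sup>2)"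
    using sub by (intro sum_mono2) (auto intro!: finite_PiE prod_nonneg)
  finally have "2 ^ card S * Z k ^ CARD('i) \<le> 2 ^ card S * (\<Sum>\<theta>\<in>?\<Theta>. \<Prod>j\<in>S. (cos (?t j \<theta>))\<^sup>2)"
    by simp
  also have "\<dots> = real N ^ CARD('i)"
    using N subset_sums_not_congruent[OF S a inj] by (intro sum_prod_cos_period S) auto
  finally show ?thesis by (simp add: Z_def c_def J_def N_def)
qed

text \<open>The preceding inequality is divided by \<open>(2 * A * M) ^ CARD('i)\<close> and
  \<open>M\<close> tends to infinity, which turns the Riemann sum into the Wallis integral.\<close>

lemma subset_sums_bound:
  fixes a :: "'j \<Rightarrow> 'i::finite \<Rightarrow> int"
  assumes S: "finite S" and A: "0 < (A::nat)"
    and a: "\<And>j. j \<in> S \<Longrightarrow> (\<Sum>i\<in>UNIV. \<bar>a j i\<bar>) \<le> int A"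
    and inj: "inj_on (\<lambda>T i. \<Sum>j\<in>T. a j i) (Pow S)"
    and k: "1 \<le> k" "real (card S) \<le> k * real CARD('i)"
  shows "2 ^ card S \<le> (2 * real A * sqrt k) ^ CARD('i)"
proof -
  define I where "I = 2 / pi * cos_powr_integral k"
  \<comment> \<open>\<open>X M\<close> is the lower bound from \<open>sum_cos_powr_ge\<close> at
    \<open>Suc M\<close>, divided by \<open>2 * A * Suc M\<close>.\<close>
  define X where "X M = (I - 1/2 * inverse (real (Suc M))) / real A" for M
  have "2 / pi * (pi / (4 * sqrt k)) \<le> I"
    unfolding I_def using cos_powr_integral_ge[OF k(1)] by (intro mult_left_mono) auto
  then have I: "1 / (2 * sqrt k) \<le> I" by simp
  have Ipos: "0 < I"
    by (rule less_le_trans[OF _ I]) (use k in simp)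
  have lim: "X \<longlonglongrightarrow> (I - 1/2 * 0) / real A"
    unfolding X_def using A by (intro tendsto_intros LIMSEQ_inverse_real_of_nat) auto
  then have lim2: "(\<lambda>M. 2 ^ card S * X M ^ CARD('i)) \<longlonglongrightarrow> 2 ^ card S * (I / real A) ^ CARD('i)"
    by (auto intro!: tendsto_intros)
  \<comment> \<open>Positivity, available for large \<open>M\<close>, allows the lower bound to be
    raised to a power.\<close>
  have "\<forall>\<^sub>F M in sequentially. 0 < X M"
    using order_tendstoD(1)[OF lim, of 0] Ipos A by simp
  then have "\<forall>\<^sub>F M in sequentially. 2 ^ card S * X M ^ CARD('i) \<le> 1"
    using eventually_ge_at_top[of "card S"]
  proof eventually_elim
    case (elim M)
    let ?M = "Suc M"
    let ?Z = "\<Sum>j\<in>{- int ?M<..<int ?M}. ((cos (pi * real_of_int j / (2 * real ?M)))\<^sup>2) powr k"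
    have "2 * real A * real ?M * X M = 2 * real ?M * I - 1"
      using A by (simp add: X_def field_simps del: of_nat_Suc)
    also have "\<dots> \<le> ?Z"
      unfolding I_def using k by (intro sum_cos_powr_ge) auto
    finally have "2 * real A * real ?M * X M \<le> ?Z" .
    then have "2 ^ card S * (2 * real A * real ?M * X M) ^ CARD('i) \<le> 2 ^ card S * ?Z ^ CARD('i)"
      using elim by (intro mult_left_mono power_mono) auto
    also have "\<dots> \<le> (2 * real A * real ?M) ^ CARD('i)"
      using elim by (intro subset_sums_power_bound[OF S A _ _ a inj k(2)]) auto
    finally have "(2 * real A * real ?M) ^ CARD('i) * (2 ^ card S * X M ^ CARD('i)) \<le> (2 * real A * real ?M) ^ CARD('i) * 1"
      by (simp only: power_mult_distrib mult_ac mult_1_right)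
    moreover have "0 < (2 * real A * real ?M) ^ CARD('i)" using A by simp
    ultimately show ?case by (simp only: mult_le_cancel_left_pos)
  qed
  then have "2 ^ card S * (I / real A) ^ CARD('i) \<le> 1"
    by (intro tendsto_upperbound[OF lim2]) auto
  moreover have "2 ^ card S * (1 / (2 * sqrt k) / real A) ^ CARD('i) \<le> 2 ^ card S * (I / real A) ^ CARD('i)"
    using I k by (intro mult_left_mono power_mono divide_right_mono) auto
  ultimately have "2 ^ card S * (1 / (2 * sqrt k) / real A) ^ CARD('i) \<le> 1" by linarith
  moreover have "(1 / (2 * sqrt k) / real A) ^ CARD('i) = 1 / (2 * real A * sqrt k) ^ CARD('i)"
    by (simp add: power_one_over mult_ac)
  moreover have "0 < (2 * real A * sqrt k) ^ CARD('i)" using A k by simp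
  ultimately show ?thesis by (simp add: pos_divide_le_eq)
qed

section \<open>Optimal solutions of minimal support\<close>

text \<open>This supplies the injectivity hypothesis of \<open>subset_sums_bound\<close>. The local
  fact \<open>no_move\<close> excludes kernel vectors with entries -1, 0, 1 inside the support that
  have a negative entry.\<close>

lemma minimal_support_inj:
  fixes A :: "int ^ 'n ^ 'm"
  assumes v: "ilp_optimal A b c v"
    and min: "\<And>y. ilp_optimal A b c y \<Longrightarrow> card (supp v) \<le> card (supp y)"
  shows "inj_on (\<lambda>T i. \<Sum>j\<in>T. A $ i $ j) (Pow (supp v))"
proof -
  have feas: "A *v v = b" "\<And>j. 0 \<le> v $ j"
    and opt: "\<And>y. ilp_feasible A b y \<Longrightarrow> scalar_product c y \<le> scalar_product c v"
    using v by (auto simp: ilp_optimal_def ilp_feasible_def less_eq_vec_def)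
  have no_move: False if x: "A *v x = 0" "\<And>j. \<bar>x $ j\<bar> \<le> 1" "supp x \<subseteq> supp v" "x $ j0 < 0" for x j0
  proof -
    \<comment> \<open>The entries of \<open>v\<close> on its support are integers and at least 1, so
      both \<open>v + x\<close> and \<open>v - x\<close> are feasible. Optimality of
      \<open>v\<close> against both forces the objective to be constant along
      \<open>x\<close>.\<close>
    have xv: "\<bar>x $ j\<bar> \<le> v $ j" for j
      using x(2)[of j] x(3) feas(2)[of j] by (cases "v $ j = 0") (auto simp: supp_def)
    have "ilp_feasible A b (v + x)" "ilp_feasible A b (v - x)"
      using feas x(1) xv
      by (auto simp: ilp_feasible_def less_eq_vec_def matrix_vector_right_distrib
          matrix_vector_mult_diff_distrib abs_le_iff) (metis add.commute diff_ge_0_iff_ge diff_minus_eq_add minus_le_iff)+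
    from this[THEN opt] have cx: "scalar_product c x = 0"
      by (simp add: scalar_product_def algebra_simps sum.distrib sum_subtractf)
    \<comment> \<open>\<open>D\<close> holds the coordinates that decrease along \<open>x\<close>.
      Moving by the least value \<open>t\<close> of \<open>v\<close> on \<open>D\<close> keeps every
      entry nonnegative and brings the entry at \<open>j1\<close> to 0.\<close>
    define D where "D = {j. x $ j = - 1}"
    have "j0 \<in> D" using x(2)[of j0] x(4) by (auto simp: D_def)
    define t where "t = Min ((\<lambda>j. v $ j) ` D)"
    have "t \<in> (\<lambda>j. v $ j) ` D" unfolding t_def using \<open>j0 \<in> D\<close> by (intro Min_in) auto
    then obtain j1 where j1: "j1 \<in> D" "t = v $ j1" by auto
    have tD: "t \<le> v $ j" if "j \<in> D" for j using that by (simp add: t_def)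
    have t0: "0 \<le> t" using j1 feas(2) by simp
    define y where "y = v + t *s x"
    have "0 \<le> y $ j" for j
    proof (cases "j \<in> D")
      case True then show ?thesis using tD[OF True] by (simp add: y_def D_def)
    next
      case False
      then have "0 \<le> x $ j" using x(2)[of j] by (auto simp: D_def)
      then show ?thesis using t0 feas(2)[of j] by (simp add: y_def)
    qed
    moreover have "A *v y = b"
    proof -
      have "A *v (t *s x) = t *s (A *v x)"
        by (simp add: vec_eq_iff matrix_vector_mult_def sum_distrib_left mult.left_commute)
      then show ?thesis
        using feas(1) x(1) by (simp add: y_def matrix_vector_right_distrib)
    qed
    ultimately have "ilp_feasible A b y" by (simp add: ilp_feasible_def less_eq_vec_def)
    moreover have "scalar_product c y = scalar_product c v + t * scalar_product c x"
      by (simp add: y_def scalar_product_def algebra_simps sum.distrib sum_distrib_left)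
    ultimately have "ilp_optimal A b c y" using opt cx by (simp add: ilp_optimal_def)
    then have "card (supp v) \<le> card (supp y)" by (rule min)
    moreover have "supp y \<subset> supp v"
    proof -
      have "supp y \<subseteq> supp v" using x(3) by (auto simp: supp_def y_def)
      moreover have "j1 \<notin> supp y" using j1 by (simp add: supp_def y_def D_def)
      moreover have "j1 \<in> supp v" proof -
        have "j1 \<in> supp x" using j1 by (simp add: supp_def D_def)
        then show ?thesis using x(3) by blast
      qed
      ultimately show ?thesis by blast
    qed
    ultimately show False using psubset_card_mono[of "supp v" "supp y"] by simp
  qed
  \<comment> \<open>One inclusion suffices by symmetry. An element of \<open>T'\<close> outside
    \<open>T\<close> provides the negative entry required by \<open>no_move\<close>.\<close>
  have sub: "T' \<subseteq> T" if T: "T \<subseteq> supp v" "T' \<subseteq> supp v"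
    and eq: "(\<lambda>i. \<Sum>j\<in>T. A $ i $ j) = (\<lambda>i. \<Sum>j\<in>T'. A $ i $ j)" for T T'
  proof (rule ccontr)
    assume "\<not> T' \<subseteq> T"
    then obtain j0 where j0: "j0 \<in> T'" "j0 \<notin> T" by blast
    define x :: "int ^ 'n" where "x = (\<chi> j. (if j \<in> T then 1 else 0) - (if j \<in> T' then 1 else 0))"
    show False
    proof (rule no_move)
      have "(\<Sum>j\<in>UNIV. A $ i $ j * x $ j) = (\<Sum>j\<in>T. A $ i $ j) - (\<Sum>j\<in>T'. A $ i $ j)" for i
        by (simp add: x_def right_diff_distrib sum_subtractf if_distrib[of "\<lambda>z. _ * z"] sum.If_cases)
      then show "A *v x = 0"
        using fun_cong[OF eq] by (simp add: matrix_vector_mult_def vec_eq_iff)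
      show "supp x \<subseteq> supp v" using T by (auto simp: supp_def x_def split: if_splits)
    qed (use j0 in \<open>auto simp: x_def\<close>)
  qed
  show ?thesis
    by (rule inj_onI) (metis PowD sub subset_antisym)
qed

section \<open>Optimisation of the logarithmic bound\<close>

theorem theorem19:
  fixes A :: "int ^ 'n ^ 'm" and b :: "int ^ 'm" and c :: "int ^ 'n" and \<alpha> :: real
  assumes "rank (map_matrix real_of_int A) = CARD('m)"
    and "\<exists>x. ilp_feasible A b x"
    and "\<exists>x. ilp_optimal A b c x"
    and "0 < \<alpha>" and "\<alpha> < 1"
  shows "\<exists>v. ilp_optimal A b c v \<and>
    real (card (supp v)) \<le>
      real CARD('m) * log 2 (sqrt (2 * log 2 (exp 1) / (exp 1 * \<alpha>)) * real_of_int (A_max A)) / (1 - \<alpha>)"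
proof -
  obtain v where v: "ilp_optimal A b c v"
    and min: "\<And>y. ilp_optimal A b c y \<Longrightarrow> card (supp v) \<le> card (supp y)"
    using assms(3) ex_has_least_nat[of "ilp_optimal A b c" _ "\<lambda>y. card (supp y)"] by blast
  define s where "s = card (supp v)"
  define m where "m = real CARD('m)"
  define N where "N = nat (A_max A)"
  define L where "L = log 2 (sqrt (2 * log 2 (exp 1) / (exp 1 * \<alpha>)) * real_of_int (A_max A))"
  have m: "0 < m" by (simp add: m_def)

  have col: "(\<Sum>i\<in>UNIV. \<bar>A $ i $ j\<bar>) \<le> A_max A" for j
  proof -
    have "norm1 (column j A) \<le> A_max A" unfolding A_max_def by (intro Max_ge) auto
    then show ?thesis by (simp add: norm1_def column_def)
  qed
  \<comment> \<open>If \<open>A_max A\<close> were not positive, the matrix would be zero,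
    contradicting its rank \<open>CARD('m) > 0\<close>.\<close>
  have pos: "0 < A_max A"
  proof (rule ccontr)
    assume "\<not> 0 < A_max A"
    then have "\<bar>A $ i $ j\<bar> \<le> 0" for i j
      using col[of j] member_le_sum[of i UNIV "\<lambda>i. \<bar>A $ i $ j\<bar>"] by simp
    then have "map_matrix real_of_int A = 0"
      by (simp add: map_matrix_def vec_eq_iff)
    then show False using assms(1) by simp
  qed
  have N: "0 < N" "int N = A_max A" "real N = real_of_int (A_max A)" using pos by (auto simp: N_def)

  have "L * ln 2 = ln (sqrt (2 / (ln 2 * (exp 1 * \<alpha>))) * real N)"
    by (simp add: L_def log_def N)
  also have "\<dots> = ln (2 / (ln 2 * (exp 1 * \<alpha>))) / 2 + ln (real N)"
    using assms(4) N(1) by (subst ln_mult) (auto simp: ln_sqrt)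
  also have "ln (2 / (ln 2 * (exp 1 * \<alpha>))) = ln 2 - (ln (ln 2) + (1 + ln \<alpha>))"
    using assms(4) by (simp add: ln_div ln_mult)
  finally have L: "L * ln 2 = (ln 2 - (ln (ln 2) + (1 + ln \<alpha>))) / 2 + ln (real N)" .
  \<comment> \<open>This is \<open>ln y \<le> y - 1\<close> at
    \<open>y = 2 * \<alpha> * k * ln 2\<close>, with equality at
    \<open>k = 1 / (2 * \<alpha> * ln 2)\<close>. The constant under the square root in
    \<open>L\<close> is exactly the intercept of this tangent.\<close>
  have tangent: "ln 2 + ln (real N) + ln k / 2 \<le> (\<alpha> * k + L) * ln 2" if "0 < k" for k :: real
  proof -
    have "ln (2 * \<alpha> * k * ln 2) \<le> 2 * \<alpha> * k * ln 2 - 1"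
      using assms(4) that by (intro ln_le_minus_one) simp
    moreover have "ln (2 * \<alpha> * k * ln 2) = ln 2 + ln \<alpha> + ln k + ln (ln 2)"
      using assms(4) that by (simp add: ln_mult)
    ultimately show ?thesis unfolding distrib_right L by argo
  qed

  have "real s * (1 - \<alpha>) \<le> m * L"
  proof (cases "real s \<le> m")
    case True
    have "0 \<le> ln (real N)" using N(1) by simp
    moreover have "ln 2 + ln (real N) + ln 1 / 2 \<le> (\<alpha> * 1 + L) * ln 2" by (rule tangent) simp
    ultimately have "1 * ln 2 \<le> (\<alpha> + L) * ln (2::real)"
      by (simp add: distrib_right)
    then have "1 - \<alpha> \<le> L" by (subst (asm) mult_le_cancel_right_pos) auto
    then show ?thesis using True assms(5) m by (intro mult_mono) auto
  next
    case False
    define k where "k = real s / m"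
    have k: "1 \<le> k" "real s = k * m" using False m by (auto simp: k_def)
    have "2 ^ s \<le> (2 * real N * sqrt k) ^ CARD('m)"
      unfolding s_def
      by (rule subset_sums_bound[of "supp v" N "\<lambda>j i. A $ i $ j"])
        (use N(1) col k minimal_support_inj[OF v min] in \<open>auto simp: s_def m_def N(2)\<close>)
    then have "ln (2 ^ s) \<le> ln ((2 * real N * sqrt k) ^ CARD('m))"
      by (intro ln_mono) auto
    then have "real s * ln 2 \<le> m * (ln 2 + ln (real N) + ln k / 2)"
      using N(1) k(1) by (simp add: ln_realpow ln_mult ln_sqrt m_def)
    also have "\<dots> \<le> m * ((\<alpha> * k + L) * ln 2)"
      using tangent[of k] k m by (intro mult_left_mono) auto
    finally have "real s * ln 2 \<le> (\<alpha> * real s + m * L) * ln 2"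
      using k(2) by (simp add: algebra_simps)
    then have "real s \<le> \<alpha> * real s + m * L"
      by (subst (asm) mult_le_cancel_right_pos) auto
    then show ?thesis by (simp add: algebra_simps)
  qed
  then have "real s \<le> m * L / (1 - \<alpha>)"
    using assms(5) by (simp add: pos_le_divide_eq)
  then show ?thesis using v unfolding s_def m_def L_def by blast
qed

end
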